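(* Let $n\ge2$ be fixed, and let $X_1,\ldots,X_n$ be i.i.d. real random variables with a continuous distribution. For $\beta>2$ let $$T_{n,\beta}=n\int_{-\infty}^{\infty}\left(M_n(t)-M_0(t)\right)^2e^{-\beta t^2}\,dt,$$ where $M_n$ is the empirical moment generating function of the scaled residuals of $X_1,\ldots,X_n$ and $M_0(t)=e^{t^2/2}$. Then, on the event $\{S_n>0\}$ (which has probability one), $$\lim_{\beta\to\infty}\frac{96}{5}\,\beta^{7/2}\left(\frac{T_{n,\beta}}{n\sqrt{\pi}}-\tau(\beta)\right)=b_{n,1}^2,$$ where $$\tau(\beta)=\frac{1}{\sqrt{\beta-1}}-\frac{2}{\sqrt{\beta-\frac12}}-\frac{2}{(4\beta-2)\sqrt{\beta-\frac12}}+\frac{1}{\sqrt{\beta}}+\frac{1}{2\beta^{3/2}}+\frac{3}{16\beta^{5/2}}$$ and $$b_{n,1}=\frac{\frac1n\sum_{i=1}^n(X_i-\overline{X}_n)^3}{S_n^3}$$ denotes the sample skewness of $X_1,\ldots,X_n$.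
   Context: Put $\overline{X}_n=n^{-1}\sum_{j=1}^n X_j$, $S_n^2=n^{-1}\sum_{j=1}^n (X_j-\overline{X}_n)^2$, $S_n=\sqrt{S_n^2}$. On the event $\{S_n>0\}$ the scaled residuals are $Y_{n,j}=(X_j-\overline{X}_n)/S_n$, $j=1,\ldots,n$, and $M_n(t)=\frac1n\sum_{j=1}^n \exp(tY_{n,j})$, $t\in\mathbb{R}$. *)

theory Defs
  imports "HOL-Probability.Probability"
begin

text \<open>
  A sample of size \<open>n\<close> is a function \<open>x :: nat \<Rightarrow> real\<close>, of which only the values at
  \<open>{1..n}\<close> matter. The empirical variance is normalised by \<open>n\<close>, not by \<open>n - 1\<close>.
\<close>

definition sample_mean :: "nat \<Rightarrow> (nat \<Rightarrow> real) \<Rightarrow> real" where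
  "sample_mean n x = (\<Sum>j = 1..n. x j) / real n"

definition sample_var :: "nat \<Rightarrow> (nat \<Rightarrow> real) \<Rightarrow> real" where
  "sample_var n x = (\<Sum>j = 1..n. (x j - sample_mean n x)\<^sup>2) / real n"

definition sample_sd :: "nat \<Rightarrow> (nat \<Rightarrow> real) \<Rightarrow> real" where
  "sample_sd n x = sqrt (sample_var n x)"

text \<open>
  The scaled residuals and everything derived from them are meaningful only if
  \<open>sample_sd n x > 0\<close>.
\<close>

definition scaled_residual :: "nat \<Rightarrow> (nat \<Rightarrow> real) \<Rightarrow> nat \<Rightarrow> real" where
  "scaled_residual n x j = (x j - sample_mean n x) / sample_sd n x"

definition empirical_mgf :: "nat \<Rightarrow> (nat \<Rightarrow> real) \<Rightarrow> real \<Rightarrow> real" where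
  "empirical_mgf n x t = (\<Sum>j = 1..n. exp (t * scaled_residual n x j)) / real n"

definition std_normal_mgf :: "real \<Rightarrow> real" where
  "std_normal_mgf t = exp (t\<^sup>2 / 2)"

text \<open>
  The integrand below is Lebesgue integrable whenever \<open>\<beta> > 1\<close>, so for \<open>\<beta> > 2\<close> the
  default value of the Bochner integral plays no role.
\<close>

definition T_stat :: "nat \<Rightarrow> real \<Rightarrow> (nat \<Rightarrow> real) \<Rightarrow> real" where
  "T_stat n \<beta> x =
     real n * (LINT t|lborel. (empirical_mgf n x t - std_normal_mgf t)\<^sup>2 * exp (- \<beta> * t\<^sup>2))"

definition sample_skewness :: "nat \<Rightarrow> (nat \<Rightarrow> real) \<Rightarrow> real" where
  "sample_skewness n x =
     ((\<Sum>i = 1..n. (x i - sample_mean n x) ^ 3) / real n) / sample_sd n x ^ 3"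

definition tau :: "real \<Rightarrow> real" where
  "tau \<beta> = 1 / sqrt (\<beta> - 1) - 2 / sqrt (\<beta> - 1/2) - 2 / ((4 * \<beta> - 2) * sqrt (\<beta> - 1/2))
     + 1 / sqrt \<beta> + 1 / (2 * \<beta> powr (3/2)) + 3 / (16 * \<beta> powr (5/2))"

end

theory Submission
  imports Defs "HOL-Real_Asymp.Real_Asymp"
begin

text \<open>
  Every integral in \<open>T_stat\<close> is Gaussian, so \<open>T_stat n \<beta> x / (n \<surd>\<pi>)\<close> is a combination of terms
  \<open>exp ((y\<^sub>j + y\<^sub>k)\<^sup>2 / (4\<beta>)) / \<surd>\<beta>\<close> and \<open>exp (y\<^sub>j\<^sup>2 / (4\<beta> - 2)) / \<surd>(\<beta> - 1/2)\<close>, up to the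
  constant \<open>1 / \<surd>(\<beta> - 1)\<close>. Expand the exponentials to third order. Since the residuals have
  mean 0 and second moment 1, the terms free of higher moments are exactly \<open>tau \<beta>\<close>, and at order
  \<open>\<beta> powr (-7/2)\<close> the contributions of the fourth and sixth moments cancel, which leaves
  \<open>5/96\<close> times the squared third moment. The sample variance vanishes only if all observations
  coincide, and two independent observations with an atomless law almost surely differ.
\<close>

section \<open>Gaussian integrals\<close>

text \<open>Completing the square makes the integrand a constant multiple of the normal density with
  mean \<open>c / (2 * a)\<close> and variance \<open>1 / (2 * a)\<close>, which has integral
  1.\<close>

lemma has_bochner_integral_gaussian_exp:
  fixes a c :: real
  assumes "a > 0"
  shows "has_bochner_integral lborel (\<lambda>t. exp (c * t) * exp (- a * t\<^sup>2))
           (sqrt pi * (exp (c\<^sup>2 / (4 * a)) / sqrt a))"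
proof -
  define s where "s = sqrt (1 / (2 * a))"
  have s: "s > 0" "s\<^sup>2 = 1 / (2 * a)"
    using assms by (auto simp: s_def)
  have "exp (c * t) * exp (- a * t\<^sup>2)
      = sqrt pi * (exp (c\<^sup>2 / (4 * a)) / sqrt a) * normal_density (c / (2 * a)) s t" for t
  proof -
    have "c * t + - a * t\<^sup>2 = c\<^sup>2 / (4 * a) + - (t - c / (2 * a))\<^sup>2 / (2 * s\<^sup>2)"
      unfolding s(2) using assms by (simp add: field_simps power2_eq_square)
    then have "exp (c * t) * exp (- a * t\<^sup>2)
        = exp (c\<^sup>2 / (4 * a)) * exp (- (t - c / (2 * a))\<^sup>2 / (2 * s\<^sup>2))"
      by (metis exp_add)
    moreover have "sqrt (2 * pi * s\<^sup>2) = sqrt pi / sqrt a"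
      unfolding s(2) by (simp add: real_sqrt_divide)
    ultimately show ?thesis
      using assms by (simp add: normal_density_def)
  qed
  moreover have "has_bochner_integral lborel (normal_density (c / (2 * a)) s) 1"
    using s(1) by (simp add: has_bochner_integral_iff integral_normal_density integrable_normal_density)
  ultimately show ?thesis
    using has_bochner_integral_mult_right[of "sqrt pi * (exp (c\<^sup>2 / (4 * a)) / sqrt a)" lborel
        "normal_density (c / (2 * a)) s" 1] by simp
qed

section \<open>Empirical moments of residuals and of their pair sums\<close>

definition empirical_moment :: "nat \<Rightarrow> (nat \<Rightarrow> real) \<Rightarrow> nat \<Rightarrow> real" where
  "empirical_moment n y p = (\<Sum>j = 1..n. y j ^ p) / real n"

text \<open>By the binomial theorem each summand splits into products of a power of
  \<open>y j\<close> and a power of \<open>y k\<close>, so the double sum factors into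
  moments.\<close>

lemma sum_pair_power:
  "(\<Sum>j = 1..n. \<Sum>k = 1..n. (y j + y k) ^ p) / (real n)\<^sup>2
     = (\<Sum>i\<le>p. real (p choose i) * empirical_moment n y i * empirical_moment n y (p - i))"
proof -
  have "(\<Sum>j = 1..n. \<Sum>k = 1..n. (y j + y k) ^ p)
      = (\<Sum>j = 1..n. \<Sum>k = 1..n. \<Sum>i\<le>p. real (p choose i) * y j ^ i * y k ^ (p - i))"
    by (simp add: binomial_ring)
  also have "\<dots> = (\<Sum>j = 1..n. \<Sum>i\<le>p. \<Sum>k = 1..n. real (p choose i) * y j ^ i * y k ^ (p - i))"
    by (intro sum.cong refl sum.swap)
  also have "\<dots> = (\<Sum>i\<le>p. \<Sum>j = 1..n. \<Sum>k = 1..n. real (p choose i) * y j ^ i * y k ^ (p - i))"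
    by (rule sum.swap)
  also have "\<dots> = (\<Sum>i\<le>p. real (p choose i) * ((\<Sum>j = 1..n. y j ^ i) * (\<Sum>k = 1..n. y k ^ (p - i))))"
    unfolding sum_product by (simp add: sum_distrib_left mult.assoc)
  finally show ?thesis
    by (simp add: empirical_moment_def sum_divide_distrib[of _ "{..p}"] power2_eq_square mult.assoc)
qed

lemma empirical_moment_scaled_residual:
  assumes "n > 0" "sample_sd n x > 0"
  shows "empirical_moment n (scaled_residual n x) 0 = 1"
    and "empirical_moment n (scaled_residual n x) 1 = 0"
    and "empirical_moment n (scaled_residual n x) 2 = 1"
    and "empirical_moment n (scaled_residual n x) 3 = sample_skewness n x"
proof -
  show "empirical_moment n (scaled_residual n x) 0 = 1"
    using assms(1) by (simp add: empirical_moment_def)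
  show "empirical_moment n (scaled_residual n x) 1 = 0"
    using assms
    by (simp add: empirical_moment_def scaled_residual_def sample_mean_def sum_subtractf
        flip: sum_divide_distrib)
  have "sample_var n x = (sample_sd n x)\<^sup>2"
    using assms(2) by (simp add: sample_sd_def)
  then show "empirical_moment n (scaled_residual n x) 2 = 1"
    using assms
    by (simp add: empirical_moment_def scaled_residual_def sample_var_def power_divide
        field_simps flip: sum_divide_distrib)
  show "empirical_moment n (scaled_residual n x) 3 = sample_skewness n x"
    by (simp add: empirical_moment_def scaled_residual_def sample_skewness_def power_divide
        flip: sum_divide_distrib)
qed

section \<open>Closed form of the statistic\<close>

text \<open>Expanding the square leaves Gaussian integrals with decay rates \<open>\<beta>\<close>,
  \<open>\<beta> - 1/2\<close> and \<open>\<beta> - 1\<close>; the last one converges because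
  \<open>\<beta> > 1\<close>.\<close>

lemma T_stat_closed_form:
  fixes x :: "nat \<Rightarrow> real"
  assumes "n > 0" "\<beta> > 1"
  defines "y \<equiv> scaled_residual n x"
  shows "T_stat n \<beta> x / (real n * sqrt pi) =
      (\<Sum>j = 1..n. \<Sum>k = 1..n. exp ((y j + y k)\<^sup>2 / (4 * \<beta>)) / sqrt \<beta>) / (real n)\<^sup>2
    - 2 * ((\<Sum>j = 1..n. exp ((y j)\<^sup>2 / (4 * \<beta> - 2)) / sqrt (\<beta> - 1/2)) / real n)
    + 1 / sqrt (\<beta> - 1)"
proof -
  \<comment> \<open>The expanded integrand is written so that every term fits the Gaussian lemma;
    the square of M_0 enters with \<open>c = 0\<close>.\<close>
  have "has_bochner_integral lborel
      (\<lambda>t. (\<Sum>j = 1..n. \<Sum>k = 1..n. exp ((y j + y k) * t) * exp (- \<beta> * t\<^sup>2)) / (real n)\<^sup>2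
         - 2 * ((\<Sum>j = 1..n. exp (y j * t) * exp (- (\<beta> - 1/2) * t\<^sup>2)) / real n)
         + exp (0 * t) * exp (- (\<beta> - 1) * t\<^sup>2))
      ((\<Sum>j = 1..n. \<Sum>k = 1..n. sqrt pi * (exp ((y j + y k)\<^sup>2 / (4 * \<beta>)) / sqrt \<beta>)) / (real n)\<^sup>2
    - 2 * ((\<Sum>j = 1..n. sqrt pi * (exp ((y j)\<^sup>2 / (4 * (\<beta> - 1/2))) / sqrt (\<beta> - 1/2))) / real n)
    + sqrt pi * (exp (0\<^sup>2 / (4 * (\<beta> - 1))) / sqrt (\<beta> - 1)))" (is "has_bochner_integral _ ?f ?I")
    using assms
    by (intro has_bochner_integral_add has_bochner_integral_diff has_bochner_integral_mult_right
        has_bochner_integral_divide has_bochner_integral_sum has_bochner_integral_gaussian_exp) auto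
  also have "?f = (\<lambda>t. (empirical_mgf n x t - std_normal_mgf t)\<^sup>2 * exp (- \<beta> * t\<^sup>2))"
  proof
    fix t
    define S where "S = (\<Sum>j = 1..n. exp (t * y j))"
    have "(\<Sum>j = 1..n. \<Sum>k = 1..n. exp ((y j + y k) * t) * exp (- \<beta> * t\<^sup>2)) = S\<^sup>2 * exp (- \<beta> * t\<^sup>2)"
      unfolding S_def power2_eq_square sum_product sum_distrib_right
      by (simp add: distrib_left exp_add mult.commute flip: sum_distrib_left)
    moreover have "exp (- (\<beta> - 1/2) * t\<^sup>2) = std_normal_mgf t * exp (- \<beta> * t\<^sup>2)"
      by (simp add: std_normal_mgf_def algebra_simps flip: exp_add)
    then have "(\<Sum>j = 1..n. exp (y j * t) * exp (- (\<beta> - 1/2) * t\<^sup>2))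
        = S * (std_normal_mgf t * exp (- \<beta> * t\<^sup>2))"
      unfolding S_def sum_distrib_right by (simp add: mult.commute)
    moreover have "exp (- (\<beta> - 1) * t\<^sup>2) = (std_normal_mgf t)\<^sup>2 * exp (- \<beta> * t\<^sup>2)"
      by (simp add: std_normal_mgf_def power2_eq_square algebra_simps flip: exp_add)
    moreover have "empirical_mgf n x t = S / real n"
      by (simp add: empirical_mgf_def S_def y_def)
    ultimately show "?f t = (empirical_mgf n x t - std_normal_mgf t)\<^sup>2 * exp (- \<beta> * t\<^sup>2)"
      by (simp add: power2_diff power_divide algebra_simps)
  qed
  finally have "T_stat n \<beta> x = real n * ?I"
    unfolding T_stat_def by (simp add: has_bochner_integral_integral_eq)
  also have "?I = sqrt pi * ((\<Sum>j = 1..n. \<Sum>k = 1..n. exp ((y j + y k)\<^sup>2 / (4 * \<beta>)) / sqrt \<beta>) / (real n)\<^sup>2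
    - 2 * ((\<Sum>j = 1..n. exp ((y j)\<^sup>2 / (4 * \<beta> - 2)) / sqrt (\<beta> - 1/2)) / real n)
    + 1 / sqrt (\<beta> - 1))"
    unfolding sum_distrib_left[symmetric] by (simp add: algebra_simps)
  finally show ?thesis
    using assms(1) by simp
qed

section \<open>Taylor remainder of the exponentials\<close>

definition exp_taylor3 :: "real \<Rightarrow> real" where
  "exp_taylor3 u = 1 + u + u\<^sup>2 / 2 + u ^ 3 / 6"

text \<open>
  The two cases used below are \<open>d = 0\<close> (from \<open>M_n\<^sup>2\<close>) and \<open>d = 2\<close> (from \<open>M_n M_0\<close>).
\<close>

lemma tendsto_exp_taylor3_remainder:
  fixes c d :: real
  shows "((\<lambda>\<beta>. \<beta> powr (7/2) * ((exp (c / (4 * \<beta> - d)) - exp_taylor3 (c / (4 * \<beta> - d)))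
      / sqrt (\<beta> - d / 4))) \<longlongrightarrow> 0) at_top"
proof (cases "c = 0")
  case False
  have pos: "\<forall>\<^sub>F \<beta> in at_top. 4 * \<beta> - d > 0"
    by real_asymp
  have "((\<lambda>\<beta>. c / (4 * \<beta> - d)) \<longlongrightarrow> 0) at_top"
    by real_asymp
  \<comment> \<open>The quotient by \<open>u ^ 3\<close> has its limit along the punctured filter
    \<open>at 0\<close>, so the argument must stay nonzero; this is why \<open>c = 0\<close>, where
    the remainder vanishes identically, is split off.\<close>
  then have "filterlim (\<lambda>\<beta>. c / (4 * \<beta> - d)) (at 0) at_top"
    unfolding filterlim_at using False by (auto intro: eventually_mono[OF pos])
  moreover have "((\<lambda>u. (exp u - exp_taylor3 u) / u ^ 3) \<longlongrightarrow> 0) (at (0::real))"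
    unfolding exp_taylor3_def by real_asymp
  ultimately have "((\<lambda>\<beta>. (exp (c / (4 * \<beta> - d)) - exp_taylor3 (c / (4 * \<beta> - d)))
      / (c / (4 * \<beta> - d)) ^ 3) \<longlongrightarrow> 0) at_top"
    by (rule filterlim_compose[rotated])
  \<comment> \<open>The cube contributes order 3 and the root order 1/2, matching the factor
    \<open>\<beta> powr (7/2)\<close>; the limit is \<open>1 / 4 ^ 3\<close>.\<close>
  moreover have "((\<lambda>\<beta>. \<beta> powr (7/2) / ((4 * \<beta> - d) ^ 3 * sqrt (\<beta> - d / 4))) \<longlongrightarrow> 1 / 64) at_top"
    by real_asymp
  ultimately have "((\<lambda>\<beta>. c ^ 3 * ((exp (c / (4 * \<beta> - d)) - exp_taylor3 (c / (4 * \<beta> - d)))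
      / (c / (4 * \<beta> - d)) ^ 3 * (\<beta> powr (7/2) / ((4 * \<beta> - d) ^ 3 * sqrt (\<beta> - d / 4)))))
      \<longlongrightarrow> c ^ 3 * (0 * (1 / 64))) at_top"
    by (intro tendsto_mult tendsto_const)
  then have "((\<lambda>\<beta>. c ^ 3 * ((exp (c / (4 * \<beta> - d)) - exp_taylor3 (c / (4 * \<beta> - d)))
      / (c / (4 * \<beta> - d)) ^ 3 * (\<beta> powr (7/2) / ((4 * \<beta> - d) ^ 3 * sqrt (\<beta> - d / 4)))))
      \<longlongrightarrow> 0) at_top"
    by simp
  then show ?thesis
  proof (rule Lim_transform_eventually)
    show "\<forall>\<^sub>F \<beta> in at_top. c ^ 3 * ((exp (c / (4 * \<beta> - d)) - exp_taylor3 (c / (4 * \<beta> - d)))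
      / (c / (4 * \<beta> - d)) ^ 3 * (\<beta> powr (7/2) / ((4 * \<beta> - d) ^ 3 * sqrt (\<beta> - d / 4))))
      = \<beta> powr (7/2) * ((exp (c / (4 * \<beta> - d)) - exp_taylor3 (c / (4 * \<beta> - d)))
      / sqrt (\<beta> - d / 4))"
      using pos by eventually_elim (use False in \<open>simp add: power_divide\<close>)
  qed
qed (simp add: exp_taylor3_def)

section \<open>The limit for a fixed sample\<close>

lemma tendsto_scaled_T_stat:
  assumes "n > 0" "sample_sd n x > 0"
  shows "((\<lambda>\<beta>. 96 / 5 * \<beta> powr (7/2) * (T_stat n \<beta> x / (real n * sqrt pi) - tau \<beta>))
           \<longlongrightarrow> (sample_skewness n x)\<^sup>2) at_top"
proof -
  define y where "y = scaled_residual n x"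
  define m where "m = empirical_moment n y"
  have m: "m 0 = 1" "m (Suc 0) = 0" "m 2 = 1" "m 3 = sample_skewness n x"
    using empirical_moment_scaled_residual[OF assms] by (simp_all add: m_def y_def)
  define R where "R c d \<beta> = \<beta> powr (7/2) * ((exp (c / (4 * \<beta> - d)) - exp_taylor3 (c / (4 * \<beta> - d)))
      / sqrt (\<beta> - d / 4))" for c d \<beta>
  have R: "(R c d \<longlongrightarrow> 0) at_top" for c d
    unfolding R_def by (rule tendsto_exp_taylor3_remainder)
  \<comment> \<open>\<open>A\<close> and \<open>B\<close> are the coefficients of the fourth and sixth moment.\<close>
  define A where "A \<beta> = \<beta> powr (7/2) * (1 / (16 * \<beta> powr (5/2)) - 1 / ((4 * \<beta> - 2)\<^sup>2 * sqrt (\<beta> - 1/2))) + 5/64"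
    for \<beta> :: real
  define B where "B \<beta> = 1/192 - \<beta> powr (7/2) / (3 * (4 * \<beta> - 2) ^ 3 * sqrt (\<beta> - 1/2))"
    for \<beta> :: real
  \<comment> \<open>The difference of the two terms in \<open>A\<close> is 1/16 of the change of
    \<open>\<beta> powr (-5/2)\<close> under a shift by 1/2, which gives -5/64 in the limit. The
    opposing 5/64 is \<open>30 / (6 * 4 ^ 3)\<close>, from the sixth pair moment.\<close>
  have A: "(A \<longlongrightarrow> 0) at_top"
    unfolding A_def by real_asymp
  have B: "(B \<longlongrightarrow> 0) at_top"
    unfolding B_def by real_asymp
  \<comment> \<open>Binomial terms containing the first moment vanish, and the second moment is
    replaced by 1.\<close>
  have pair: "(\<Sum>j = 1..n. \<Sum>k = 1..n. (y j + y k)\<^sup>2) / (real n)\<^sup>2 = 2"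
      "(\<Sum>j = 1..n. \<Sum>k = 1..n. (y j + y k) ^ 4) / (real n)\<^sup>2 = 2 * m 4 + 6"
      "(\<Sum>j = 1..n. \<Sum>k = 1..n. (y j + y k) ^ 6) / (real n)\<^sup>2 = 2 * m 6 + 30 * m 4 + 20 * (m 3)\<^sup>2"
    unfolding sum_pair_power m_def[symmetric]
    by (simp_all add: numeral_nat m m(3,4)[unfolded numeral_nat] power2_eq_square)
  have pair_taylor: "(\<Sum>j = 1..n. \<Sum>k = 1..n. exp_taylor3 ((y j + y k)\<^sup>2 / b)) / (real n)\<^sup>2
      = 1 + 2 / b + (2 * m 4 + 6) / (2 * b\<^sup>2) + (2 * m 6 + 30 * m 4 + 20 * (m 3)\<^sup>2) / (6 * b ^ 3)" for b
  proof -
    have "(\<Sum>j = 1..n. \<Sum>k = 1..n. exp_taylor3 ((y j + y k)\<^sup>2 / b)) / (real n)\<^sup>2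
      = 1 + (\<Sum>j = 1..n. \<Sum>k = 1..n. (y j + y k)\<^sup>2) / (real n)\<^sup>2 / b
          + (\<Sum>j = 1..n. \<Sum>k = 1..n. (y j + y k) ^ 4) / (real n)\<^sup>2 / (2 * b\<^sup>2)
          + (\<Sum>j = 1..n. \<Sum>k = 1..n. (y j + y k) ^ 6) / (real n)\<^sup>2 / (6 * b ^ 3)"
      using assms(1)
      by (simp add: exp_taylor3_def sum.distrib power_divide add_divide_distrib
          power2_eq_square[of "real n"] mult.commute flip: sum_divide_distrib power_mult)
    then show ?thesis
      unfolding pair .
  qed
  have single_taylor: "(\<Sum>j = 1..n. exp_taylor3 ((y j)\<^sup>2 / b)) / real n
      = 1 + 1 / b + m 4 / (2 * b\<^sup>2) + m 6 / (6 * b ^ 3)" for b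
    using assms(1) m(3)
    by (simp add: exp_taylor3_def m_def empirical_moment_def mult_ac sum.distrib power_divide add_divide_distrib flip: sum_divide_distrib power_mult)
  \<comment> \<open>Every term but the last tends to 0; \<open>5 / 96\<close> is
    \<open>20 / (6 * 4 ^ 3)\<close>, with 20 the middle binomial coefficient of the sixth pair
    moment.\<close>
  have "((\<lambda>\<beta>. 96 / 5 * ((\<Sum>j = 1..n. \<Sum>k = 1..n. R ((y j + y k)\<^sup>2) 0 \<beta>) / (real n)\<^sup>2
      - 2 * ((\<Sum>j = 1..n. R ((y j)\<^sup>2) 2 \<beta>) / real n) + m 4 * A \<beta> + m 6 * B \<beta> + 5 / 96 * (m 3)\<^sup>2))
      \<longlongrightarrow> 96 / 5 * ((\<Sum>j = 1..n. \<Sum>k = 1..n. 0) / (real n)\<^sup>2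
      - 2 * ((\<Sum>j = 1..n. 0) / real n) + m 4 * 0 + m 6 * 0 + 5 / 96 * (m 3)\<^sup>2)) at_top"
    using assms(1) by (intro tendsto_intros R A B) auto
  then have "((\<lambda>\<beta>. 96 / 5 * ((\<Sum>j = 1..n. \<Sum>k = 1..n. R ((y j + y k)\<^sup>2) 0 \<beta>) / (real n)\<^sup>2
      - 2 * ((\<Sum>j = 1..n. R ((y j)\<^sup>2) 2 \<beta>) / real n) + m 4 * A \<beta> + m 6 * B \<beta> + 5 / 96 * (m 3)\<^sup>2))
      \<longlongrightarrow> (sample_skewness n x)\<^sup>2) at_top"
    by (simp add: m)
  \<comment> \<open>This is an exact identity for \<open>\<beta> > 1\<close>, not an asymptotic one:
    all errors are already collected in \<open>R\<close>, \<open>A\<close> and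
    \<open>B\<close>.\<close>
  moreover have "\<forall>\<^sub>F \<beta> in at_top. 96 / 5 * ((\<Sum>j = 1..n. \<Sum>k = 1..n. R ((y j + y k)\<^sup>2) 0 \<beta>) / (real n)\<^sup>2
      - 2 * ((\<Sum>j = 1..n. R ((y j)\<^sup>2) 2 \<beta>) / real n) + m 4 * A \<beta> + m 6 * B \<beta> + 5 / 96 * (m 3)\<^sup>2)
      = 96 / 5 * \<beta> powr (7/2) * (T_stat n \<beta> x / (real n * sqrt pi) - tau \<beta>)"
    using eventually_gt_at_top[of 1]
  proof eventually_elim
    case (elim \<beta>)
    define p where "p = \<beta> powr (7/2)"
    define r where "r = sqrt \<beta>"
    define q where "q = sqrt (\<beta> - 1/2)"
    define E where "E = (\<Sum>j = 1..n. \<Sum>k = 1..n. exp ((y j + y k)\<^sup>2 / (4 * \<beta>))) / (real n)\<^sup>2"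
    define F where "F = (\<Sum>j = 1..n. exp ((y j)\<^sup>2 / (4 * \<beta> - 2))) / real n"
    have pos: "r > 0"
      using elim by (simp add: r_def)
    have r2: "\<beta> = r\<^sup>2"
      using elim by (simp add: r_def)
    have powr: "\<beta> powr (k/2) = r ^ k'" if "k = real k'" for k k'
    proof -
      have "\<beta> powr (k/2) = (\<beta> powr (1/2)) powr k"
        by (simp add: powr_powr)
      then show ?thesis
        using elim that pos by (simp add: powr_half_sqrt r_def powr_realpow)
    qed
    have p: "p = r ^ 7" and p5: "\<beta> powr (5/2) = r ^ 5" and p3: "\<beta> powr (3/2) = r ^ 3"
      unfolding p_def by (intro powr; simp)+
    have R_factor: "R c d \<beta> = p / sqrt (\<beta> - d / 4)
        * (exp (c / (4 * \<beta> - d)) - exp_taylor3 (c / (4 * \<beta> - d)))" for c d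
      by (simp add: R_def p_def)
    have R1: "(\<Sum>j = 1..n. \<Sum>k = 1..n. R ((y j + y k)\<^sup>2) 0 \<beta>) / (real n)\<^sup>2
        = p * ((E - (1 + 2 / (4 * \<beta>) + (2 * m 4 + 6) / (2 * (4 * \<beta>)\<^sup>2)
          + (2 * m 6 + 30 * m 4 + 20 * (m 3)\<^sup>2) / (6 * (4 * \<beta>) ^ 3))) / r)"
      unfolding pair_taylor[symmetric] E_def R_factor sum_distrib_left[symmetric] sum_subtractf
        diff_divide_distrib[symmetric] by (simp add: r_def)
    have R2: "(\<Sum>j = 1..n. R ((y j)\<^sup>2) 2 \<beta>) / real n
        = p * ((F - (1 + 1 / (4 * \<beta> - 2) + m 4 / (2 * (4 * \<beta> - 2)\<^sup>2) + m 6 / (6 * (4 * \<beta> - 2) ^ 3))) / q)"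
      unfolding single_taylor[symmetric] F_def R_factor sum_distrib_left[symmetric] sum_subtractf
        diff_divide_distrib[symmetric] by (simp add: q_def)
    have T: "T_stat n \<beta> x / (real n * sqrt pi) = E / r - 2 * (F / q) + 1 / sqrt (\<beta> - 1)"
      using T_stat_closed_form[OF assms(1) elim, of x]
      by (simp add: E_def F_def y_def r_def q_def mult.commute flip: sum_divide_distrib)
    \<comment> \<open>With \<open>\<beta>\<close> written as \<open>r\<^sup>2\<close>, the identity
      holds formally in \<open>r\<close>, \<open>D\<close>, \<open>w\<close> and \<open>v\<close>;
      keeping the last three opaque leaves only powers of \<open>r\<close> to clear from
      denominators.\<close>
    define D where "D = 1 / sqrt (\<beta> - 1)"
    define w where "w = 1 / (4 * \<beta> - 2)"
    define v where "v = 1 / q"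
    have A': "A \<beta> = p * (1 / (16 * r ^ 5) - w\<^sup>2 * v) + 5/64"
      by (simp add: A_def p5 p_def w_def v_def q_def field_simps power_divide)
    have B': "B \<beta> = 1/192 - p * w ^ 3 * v / 3"
      by (simp add: B_def p_def w_def v_def q_def power_divide)
    have tau: "tau \<beta> = D - 2 * v - 2 * w * v + 1 / r + 1 / (2 * r ^ 3) + 3 / (16 * r ^ 5)"
      by (simp add: tau_def p3 p5 D_def w_def v_def q_def r_def)
    have R2': "(\<Sum>j = 1..n. R ((y j)\<^sup>2) 2 \<beta>) / real n
        = p * (F - (1 + w + m 4 * w\<^sup>2 / 2 + m 6 * w ^ 3 / 6)) * v"
      unfolding R2 by (simp add: w_def v_def power_divide)
    have T': "T_stat n \<beta> x / (real n * sqrt pi) = E / r - 2 * F * v + D"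
      unfolding T by (simp add: v_def D_def)
    show ?case
      unfolding R1 R2' T' tau A' B' p_def[symmetric] unfolding p unfolding r2
      using pos by (simp add: field_simps eval_nat_numeral)
  qed
  ultimately show ?thesis
    by (rule Lim_transform_eventually)
qed

section \<open>Almost sure positivity of the sample deviation\<close>

text \<open>By independence the joint law is a product, so it suffices that each section of the
  diagonal is null; a section is a single point, and a continuous cdf has no atoms.\<close>

lemma (in prob_space) AE_neq_indep_continuous:
  fixes X Y :: "'a \<Rightarrow> real"
  assumes "indep_var borel X borel Y" and "continuous_on UNIV (cdf (distr M borel Y))"
  shows "AE \<omega> in M. X \<omega> \<noteq> Y \<omega>"
proof -
  have rv [measurable]: "random_variable borel X" "random_variable borel Y"
    using assms(1) by (auto dest: indep_var_rv1 indep_var_rv2)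
  interpret DX: real_distribution "distr M borel X"
    by (rule real_distribution_distr) simp
  interpret DY: real_distribution "distr M borel Y"
    by (rule real_distribution_distr) simp
  interpret pair_sigma_finite "distr M borel X" "distr M borel Y" ..
  have "AE v in distr M borel Y. u \<noteq> v" for u
  proof -
    have "measure (distr M borel Y) {u} = 0"
      using assms(2) DY.isCont_cdf[of u] by (auto simp: continuous_on_eq_continuous_at)
    then show ?thesis
      by (intro AE_I[of _ _ "{u}"]) (auto simp: DY.emeasure_eq_measure)
  qed
  moreover have "{z \<in> space (distr M borel X \<Otimes>\<^sub>M distr M borel Y). fst z \<noteq> snd z}
      \<in> sets (distr M borel X \<Otimes>\<^sub>M distr M borel Y)"
    by measurable
  ultimately have "AE z in distr M borel X \<Otimes>\<^sub>M distr M borel Y. fst z \<noteq> snd z"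
    by (intro AE_pair_measure) auto
  also have "distr M borel X \<Otimes>\<^sub>M distr M borel Y
      = distr M (borel \<Otimes>\<^sub>M borel) (\<lambda>\<omega>. (X \<omega>, Y \<omega>))"
    using assms(1) by (simp add: indep_var_distribution_eq)
  finally have "AE z in distr M (borel \<Otimes>\<^sub>M borel) (\<lambda>\<omega>. (X \<omega>, Y \<omega>)). fst z \<noteq> snd z" .
  then show ?thesis
    by (simp add: AE_distr_iff)
qed

text \<open>Two distinct values cannot both equal the mean, so some squared deviation is
  positive.\<close>

lemma sample_sd_pos:
  assumes "i \<in> {1..n}" "j \<in> {1..n}" "x i \<noteq> x j"
  shows "sample_sd n x > 0"
proof -
  have "\<exists>k\<in>{1..n}. x k \<noteq> sample_mean n x"
    using assms by (cases "x i = sample_mean n x") (auto intro: bexI[of _ j] bexI[of _ i])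
  then have "(\<Sum>k = 1..n. (x k - sample_mean n x)\<^sup>2) \<noteq> 0"
    by (simp add: sum_nonneg_eq_0_iff)
  moreover have "(\<Sum>k = 1..n. (x k - sample_mean n x)\<^sup>2) \<ge> 0"
    by (simp add: sum_nonneg)
  ultimately show ?thesis
    using assms(1) by (simp add: sample_sd_def sample_var_def)
qed

theorem theorem4:
  fixes M :: "'a measure" and X :: "nat \<Rightarrow> 'a \<Rightarrow> real" and n :: nat
  assumes "prob_space M"
    and "n \<ge> 2"
    and "prob_space.indep_vars M (\<lambda>_. borel) X {1..n}"
    and "\<And>i j. i \<in> {1..n} \<Longrightarrow> j \<in> {1..n} \<Longrightarrow> distr M borel (X i) = distr M borel (X j)"
    and "\<And>i. i \<in> {1..n} \<Longrightarrow> continuous_on UNIV (cdf (distr M borel (X i)))"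
  shows "measure M {\<omega> \<in> space M. sample_sd n (\<lambda>j. X j \<omega>) > 0} = 1
    \<and> (\<forall>\<omega> \<in> space M. sample_sd n (\<lambda>j. X j \<omega>) > 0 \<longrightarrow>
         ((\<lambda>\<beta>. 96 / 5 * \<beta> powr (7/2) *
                 (T_stat n \<beta> (\<lambda>j. X j \<omega>) / (real n * sqrt pi) - tau \<beta>))
           \<longlongrightarrow> (sample_skewness n (\<lambda>j. X j \<omega>))\<^sup>2) at_top)"
proof -
  interpret prob_space M by fact
  have rv [measurable]: "random_variable borel (X i)" if "i \<in> {1..n}" for i
    using assms(3) that by (simp add: indep_vars_def)
  \<comment> \<open>The shape \<open>insert 1 {2}\<close> fits \<open>indep_vars_sum\<close>, where
    the sum over \<open>{2}\<close> collapses to \<open>X 2\<close>.\<close>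
  have "indep_vars (\<lambda>_. borel) X (insert 1 {2})"
    using assms(2) by (intro indep_vars_subset[OF assms(3)]) auto
  then have "indep_var borel (X 1) borel (X 2)"
    using indep_vars_sum[of "{2}" 1 X] by simp
  then have "AE \<omega> in M. X 1 \<omega> \<noteq> X 2 \<omega>"
    using assms(2) by (intro AE_neq_indep_continuous assms(5)) auto
  then have "AE \<omega> in M. sample_sd n (\<lambda>j. X j \<omega>) > 0"
    by eventually_elim (rule sample_sd_pos[of 1 _ 2], use assms(2) in auto)
  moreover have "{\<omega> \<in> space M. sample_sd n (\<lambda>j. X j \<omega>) > 0} \<in> events"
    unfolding sample_sd_def sample_var_def sample_mean_def by measurable
  ultimately have "prob {\<omega> \<in> space M. sample_sd n (\<lambda>j. X j \<omega>) > 0} = 1"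
    by (simp add: prob_Collect_eq_1)
  then show ?thesis
    using assms(2) by (intro conjI ballI impI tendsto_scaled_T_stat) auto
qed

end
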